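(* Let $H$ be a real Hilbert space, let $A,B:H\rightrightarrows H$ be maximal monotone operators, and let $\{z_k\}_{k\ge 0},\{w_k\}_{k\ge 0}$, $\{a_k\}_{k\ge1}$, $\{y_k\}_{k\ge1}$, $\{b_k\}_{k\ge1}$, $\{x_k\}_{k\ge1}$ be sequences generated by Algorithm II (described in the context). If $S_e(A,B)\neq\emptyset$, then the sequences $\{(x_k,b_k)\}$, $\{(y_k,-a_k)\}$ and $\{(z_k,w_k)\}$ converge weakly (in $H\times H$) to a point in $S_e(A,B)$; that is, there is a point of $S_e(A,B)$ to which all three sequences converge weakly.
   Context: $H$ is a real Hilbert space with inner product $\langle\cdot,\cdot\rangle$ and induced norm $\|\cdot\|$; $H\times H$ carries the canonical product inner product. $A,B:H\rightrightarrows H$ are maximal monotone (set-valued) operators. Extended solution set: $S_e(A,B)=\{(z,w)\in H\times H : w\in B(z),\ -w\in A(z)\}$. $\varepsilon$-enlargement: for a maximal monotone $T:H\rightrightarrows H$, $\varepsilon\ge 0$, $z\in H$, $$T^{[\varepsilon]}(z)=\{v\in H : \langle z-z',v-v'\rangle\ge-\varepsilon\ \ \forall z'\in H,\ v'\in T(z')\}.$$ Algorithm II (semi-inexact Douglas-Rachford method with relative error tolerance): fix $z_0,w_0\in H$, $\lambda>0$, and $0<\sigma<\nu<1$. For $k=1,2,3,\dots$: (1) Compute $a_k,y_k\in H$ such that $a_k\in A(y_k)$ and $\lambda a_k+y_k=z_{k-1}-\lambda w_{k-1}$. Then compute $b_k,x_k\in H$ and $\mu_k\ge0$ (any choice is allowed)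 such that $b_k\in B^{[\mu_k]}(x_k)$ and $\delta_k\le\sigma^2\rho_k$, where $$\delta_k=\|\lambda b_k+x_k-(y_k+\lambda w_{k-1})\|^2+2\lambda\mu_k,\qquad \rho_k=\|\lambda(a_k+b_k)\|^2+\|x_k-y_k\|^2.$$ (2) Set $t_k=0$ if $a_k+b_k=x_k-y_k=0$, and otherwise $$t_k=\nu^2\max\left\{0,\ \frac{\delta_k}{\sigma^2\rho_k}-\frac{\|\lambda(a_k+w_{k-1})\|^2}{\rho_k}\right\};$$ then set $z_k=z_{k-1}-(1-t_k)\lambda(a_k+b_k)$ and $w_k=w_{k-1}-(1-t_k)\lambda^{-1}(x_k-y_k)$. *)

theory Defs
  imports "HOL-Analysis.Analysis"
begin

text \<open>A real Hilbert space is a type of sort \<open>{real_inner, complete_space}\<close>; a set-valued operator on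
  it is a function into sets.\<close>

definition monotone_operator :: "('a::real_inner \<Rightarrow> 'a set) \<Rightarrow> bool" where
  "monotone_operator T \<longleftrightarrow> (\<forall>z z' v v'. v \<in> T z \<longrightarrow> v' \<in> T z' \<longrightarrow> inner (z - z') (v - v') \<ge> 0)"

definition maximal_monotone :: "('a::real_inner \<Rightarrow> 'a set) \<Rightarrow> bool" where
  "maximal_monotone T \<longleftrightarrow> monotone_operator T \<and>
     (\<forall>S. monotone_operator S \<longrightarrow> (\<forall>z. T z \<subseteq> S z) \<longrightarrow> S = T)"

definition enlargement :: "('a::real_inner \<Rightarrow> 'a set) \<Rightarrow> real \<Rightarrow> 'a \<Rightarrow> 'a set" where
  "enlargement T \<epsilon> z = {v. \<forall>z'. \<forall>v'\<in>T z'. inner (z - z') (v - v') \<ge> - \<epsilon>}"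

definition extended_solution_set ::
  "('a::real_inner \<Rightarrow> 'a set) \<Rightarrow> ('a \<Rightarrow> 'a set) \<Rightarrow> ('a \<times> 'a) set" where
  "extended_solution_set A B = {(z, w). w \<in> B z \<and> - w \<in> A z}"

definition weakly_converges :: "(nat \<Rightarrow> 'a::real_inner) \<Rightarrow> 'a \<Rightarrow> bool" where
  "weakly_converges X p \<longleftrightarrow> (\<forall>h. (\<lambda>k. inner (X k) h) \<longlonglongrightarrow> inner p h)"

text \<open>In the next three definitions \<open>w\<close> stands for the previous iterate
  \<open>w\<^sub>k\<^sub>-\<^sub>1\<close>, the other arguments for the quantities of step \<open>k\<close>;
  \<open>l\<close> is the stepsize \<open>\<lambda>\<close>.\<close>

definition dr_delta :: "real \<Rightarrow> 'a::real_inner \<Rightarrow> 'a \<Rightarrow> 'a \<Rightarrow> 'a \<Rightarrow> real \<Rightarrow> real" where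
  "dr_delta l w y b x \<mu> = (norm (l *\<^sub>R b + x - (y + l *\<^sub>R w)))\<^sup>2 + 2 * l * \<mu>"

definition dr_rho :: "real \<Rightarrow> 'a::real_inner \<Rightarrow> 'a \<Rightarrow> 'a \<Rightarrow> 'a \<Rightarrow> real" where
  "dr_rho l a y b x = (norm (l *\<^sub>R (a + b)))\<^sup>2 + (norm (x - y))\<^sup>2"

definition dr_t ::
  "real \<Rightarrow> real \<Rightarrow> real \<Rightarrow> 'a::real_inner \<Rightarrow> 'a \<Rightarrow> 'a \<Rightarrow> 'a \<Rightarrow> 'a \<Rightarrow> real \<Rightarrow> real" where
  "dr_t l \<sigma> \<nu> w a y b x \<mu> =
     (if a + b = 0 \<and> x - y = 0 then 0
      else \<nu>\<^sup>2 * max 0 (dr_delta l w y b x \<mu> / (\<sigma>\<^sup>2 * dr_rho l a y b x)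
                        - (norm (l *\<^sub>R (a + w)))\<^sup>2 / dr_rho l a y b x))"

text \<open>The sequences \<open>a\<close>, \<open>y\<close>, \<open>b\<close>, \<open>x\<close>, \<open>\<mu>\<close> start at index 1; their values at 0 are unconstrained.\<close>

definition semi_inexact_DR ::
  "('a::real_inner \<Rightarrow> 'a set) \<Rightarrow> ('a \<Rightarrow> 'a set) \<Rightarrow> real \<Rightarrow> real \<Rightarrow> real \<Rightarrow>
   (nat \<Rightarrow> 'a) \<Rightarrow> (nat \<Rightarrow> 'a) \<Rightarrow> (nat \<Rightarrow> 'a) \<Rightarrow> (nat \<Rightarrow> 'a) \<Rightarrow> (nat \<Rightarrow> 'a) \<Rightarrow> (nat \<Rightarrow> 'a) \<Rightarrow>
   (nat \<Rightarrow> real) \<Rightarrow> bool" where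
  "semi_inexact_DR A B l \<sigma> \<nu> z w a y b x \<mu> \<longleftrightarrow>
     (\<forall>k\<ge>1.
        a k \<in> A (y k) \<and>
        l *\<^sub>R a k + y k = z (k - 1) - l *\<^sub>R w (k - 1) \<and>
        \<mu> k \<ge> 0 \<and>
        b k \<in> enlargement B (\<mu> k) (x k) \<and>
        dr_delta l (w (k - 1)) (y k) (b k) (x k) (\<mu> k) \<le> \<sigma>\<^sup>2 * dr_rho l (a k) (y k) (b k) (x k) \<and>
        (let t = dr_t l \<sigma> \<nu> (w (k - 1)) (a k) (y k) (b k) (x k) (\<mu> k) in
           z k = z (k - 1) - ((1 - t) * l) *\<^sub>R (a k + b k) \<and>
           w k = w (k - 1) - ((1 - t) * inverse l) *\<^sub>R (x k - y k)))"

end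

theory Submission
  imports Defs
begin

text \<open>
  Put \<open>s = l (a\<^sub>k + w\<^sub>k\<^sub>-\<^sub>1) = z\<^sub>k\<^sub>-\<^sub>1 - y\<^sub>k\<close>,
  \<open>d = x\<^sub>k - y\<^sub>k\<close> and \<open>e = l b\<^sub>k + x\<^sub>k - (y\<^sub>k + l w\<^sub>k\<^sub>-\<^sub>1)\<close>, and measure
  pairs \<open>(z, w)\<close> by the norm of \<open>(z, l w)\<close>.  Step \<open>k\<close> defines an affine function
  \<open>\<langle>z - x\<^sub>k, b\<^sub>k - w\<rangle> + \<langle>z - y\<^sub>k, a\<^sub>k + w\<rangle>\<close> that is at most \<open>\<mu>\<^sub>k\<close> on the extended solution set,
  and \<open>l\<close> times its value at the current iterate is exactly \<open>(\<rho> + \<parallel>s\<parallel>\<^sup>2 - \<parallel>e\<parallel>\<^sup>2) / 2\<close>.  The update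
  moves against its gradient, which gives the Fejer inequality \<open>fejer_step\<close>: the squared distance to any
  solution drops by at least \<open>(1 - t) (t \<rho> + \<parallel>s\<parallel>\<^sup>2 - \<delta>)\<close>.  The choice of \<open>t\<close> makes the
  second factor at least
  \<open>(\<nu>\<^sup>2 / \<sigma>\<^sup>2 - 1) \<delta> + (1 - \<nu>\<^sup>2) \<parallel>s\<parallel>\<^sup>2\<close>.  Hence distances to solutions converge, and \<open>\<delta>\<close>, \<open>s\<close>,
  \<open>e\<close>, \<open>\<mu>\<close> and \<open>t \<rho>\<close> tend to zero.

  The difference \<open>d = x\<^sub>k - y\<^sub>k\<close> itself is not controlled; only \<open>t d\<close> is, because
  \<open>t\<^sup>2 \<parallel>d\<parallel>\<^sup>2 \<le> t \<rho>\<close>.  This suffices, as both relevant differences have no other \<open>d\<close>-term: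
  \<open>x\<^sub>k - z\<^sub>k = t d + (1 - t) e - t s\<close> and \<open>l (b\<^sub>k - w\<^sub>k) = e - t d\<close>.  So \<open>(x\<^sub>k, b\<^sub>k)\<close> is strongly
  asymptotic to \<open>(z\<^sub>k, w\<^sub>k)\<close>, and so is the point \<open>(y\<^sub>k\<^sub>+\<^sub>1, - a\<^sub>k\<^sub>+\<^sub>1)\<close> of the \<^emph>\<open>next\<close> step.  In the sum of the
  two monotonicity inequalities for these points the products of two weakly convergent sequences cancel,
  so every weak cluster point is a solution
  (\<open>weak_cluster_in_extended_solution_set\<close>).  Opial's lemma then gives weak convergence
  of \<open>(z\<^sub>k, w\<^sub>k)\<close>, and the other two sequences follow.

  Weak cluster points are taken along filters finer than the given one instead of along
  subsequences.  Their existence is then Tychonoff's theorem for the coordinates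
  \<open>h \<mapsto> \<langle>X\<^sub>i, h\<rangle>\<close> together with the Riesz representation of the limit functional.
\<close>

section \<open>Weak compactness and Opial's lemma in Hilbert spaces\<close>

text \<open>The representing vector is the minimiser of \<open>J x = \<parallel>x\<parallel>\<^sup>2 - 2 f x\<close>: by the parallelogram law
  minimising sequences are Cauchy, and the derivative of \<open>J\<close> in the direction \<open>h\<close> vanishes at
  the minimiser \<open>p\<close> exactly when \<open>f h = \<langle>p, h\<rangle>\<close>.\<close>

lemma riesz_representation_inner:
  fixes f :: "'a::{real_inner, complete_space} \<Rightarrow> real"
  assumes f: "bounded_linear f"
  obtains p where "\<And>h. f h = inner p h"
proof -
  interpret f: bounded_linear f by (rule f)
  define J where "J x = (norm x)\<^sup>2 - 2 * f x" for x
  obtain K where K: "\<And>x. \<bar>f x\<bar> \<le> norm x * K"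
    using f.bounded by auto
  have below: "- K\<^sup>2 \<le> J x" for x
  proof -
    have "0 \<le> (norm x - K)\<^sup>2" by simp
    then show ?thesis
      using K[of x] by (simp add: J_def power2_diff)
  qed
  then have bdd: "bdd_below (range J)" by (auto intro!: bdd_belowI)
  define d where "d = (INF x. J x)"
  have d_le: "d \<le> J x" for x
    unfolding d_def by (rule cINF_lower[OF bdd]) simp
  have "\<exists>x. J x < d + 1 / real (Suc n)" for n
    using cINF_less_iff[OF _ bdd, of "d + 1 / real (Suc n)"] unfolding d_def by simp
  then obtain X where X: "\<And>n. J (X n) < d + 1 / real (Suc n)" by metis
  have gap: "(norm (x - y))\<^sup>2 \<le> 2 * (J x - d) + 2 * (J y - d)" for x y
  proof -
    define m where "m = (1/2) *\<^sub>R (x + y)"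
    have "(norm (x - y))\<^sup>2 = 2 * J x + 2 * J y - 4 * J m"
      by (simp add: m_def J_def f.scale f.add power2_norm_eq_inner inner_simps inner_commute
          field_simps)
    then show ?thesis using d_le[of m] by argo
  qed
  have "Cauchy X"
  proof (rule metric_CauchyI)
    fix e :: real assume "0 < e"
    then have "0 < e\<^sup>2 / 4" by simp
    then obtain N where N: "1 / real (Suc N) < e\<^sup>2 / 4"
      using nat_approx_posE by blast
    show "\<exists>M. \<forall>m\<ge>M. \<forall>n\<ge>M. dist (X m) (X n) < e"
    proof (intro exI allI impI)
      fix m n assume mn: "N \<le> m" "N \<le> n"
      have "1 / real (Suc m) \<le> 1 / real (Suc N)" "1 / real (Suc n) \<le> 1 / real (Suc N)"
        using mn by (simp_all add: frac_le)
      then have "(norm (X m - X n))\<^sup>2 < e\<^sup>2"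
        using gap[of "X m" "X n"] X[of m] X[of n] N by argo
      then show "dist (X m) (X n) < e"
        using \<open>0 < e\<close> by (simp add: dist_norm power2_less_imp_less)
    qed
  qed
  then obtain p where p: "X \<longlonglongrightarrow> p" using Cauchy_convergent convergent_def by blast
  have "(\<lambda>n. J (X n)) \<longlonglongrightarrow> J p"
    unfolding J_def by (intro tendsto_intros p f.tendsto)
  moreover have "(\<lambda>n. d + 1 / real (Suc n)) \<longlonglongrightarrow> d + 0"
    by (intro tendsto_intros) (rule LIMSEQ_Suc[OF lim_1_over_n])
  ultimately have Jp: "J p \<le> d"
    using LIMSEQ_le[of "\<lambda>n. J (X n)" "J p" "\<lambda>n. d + 1 / real (Suc n)" d] X less_imp_le by auto
  have "f h = inner p h" for h
  proof -
    \<comment> \<open>The derivative in the direction \<open>h\<close> is \<open>2 c\<close>, and \<open>- c s\<close> is a step against it; \<open>s\<close> is so small that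
      the quadratic term is at most half of the linear gain.\<close>
    define c s where "c = inner p h - f h" and "s = 1 / ((norm h)\<^sup>2 + 1)"
    have s: "0 < s" "s * (norm h)\<^sup>2 \<le> 1"
      using add_nonneg_pos[of "(norm h)\<^sup>2" 1] by (simp_all add: s_def)
    have "J p \<le> J (p + (- (c * s)) *\<^sub>R h)" using Jp d_le order_trans by blast
    also have "\<dots> = J p - 2 * s * c\<^sup>2 + s * c\<^sup>2 * (s * (norm h)\<^sup>2)"
      unfolding J_def f.add f.scaleR power2_norm_eq_inner
      by (simp add: c_def inner_simps inner_commute algebra_simps power2_eq_square)
    also have "\<dots> \<le> J p - 2 * s * c\<^sup>2 + s * c\<^sup>2 * 1"
      using s by (intro add_left_mono mult_left_mono) auto
    finally have "s * c\<^sup>2 \<le> 0" by simp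
    then have "c = 0" using s(1) by (simp add: mult_le_0_iff)
    then show ?thesis by (simp add: c_def)
  qed
  then show thesis by (rule that)
qed

text \<open>A bounded family, seen as a family of functions \<open>h \<mapsto> \<langle>X\<^sub>i, h\<rangle>\<close>, lies in a product of compact
  intervals.  A cluster point \<open>f\<close> of it in the product topology is linear and bounded, since these
  properties pass to pointwise limits; refining \<open>F\<close> by the neighbourhoods of \<open>f\<close> turns the
  cluster point into a limit.\<close>

lemma bounded_imp_weakly_convergent_subfilter:
  fixes X :: "'i \<Rightarrow> 'a::{real_inner, complete_space}"
  assumes F: "F \<noteq> bot" and X: "\<And>i. norm (X i) \<le> M"
  obtains G p where "G \<le> F" "G \<noteq> bot" "\<And>h. ((\<lambda>i. inner (X i) h) \<longlongrightarrow> inner p h) G"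
proof -
  define \<phi> where "\<phi> i = (\<lambda>h. inner (X i) h)" for i
  define K where "K = PiE UNIV (\<lambda>h::'a. {- (M * norm h)..M * norm h})"
  have "compactin (product_topology (\<lambda>h::'a. euclidean) UNIV) K"
    unfolding K_def compactin_PiE by auto
  then have "compact K"
    by (simp add: euclidean_product_topology)
  have "\<phi> i \<in> K" for i
  proof -
    have "\<bar>inner (X i) h\<bar> \<le> M * norm h" for h
      using Cauchy_Schwarz_ineq2[of "X i" h] X[of i] by (meson mult_right_mono norm_ge_zero order_trans)
    then show ?thesis by (auto simp: K_def \<phi>_def abs_le_iff) (metis minus_le_iff)
  qed
  then have "eventually (\<lambda>g. g \<in> K) (filtermap \<phi> F)"
    by (simp add: eventually_filtermap)
  moreover have "filtermap \<phi> F \<noteq> bot" using F by (simp add: filtermap_bot_iff)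
  ultimately obtain f where f: "f \<in> K" and nt: "inf (nhds f) (filtermap \<phi> F) \<noteq> bot"
    using \<open>compact K\<close> unfolding compact_filter by blast
  define G where "G = inf F (filtercomap \<phi> (nhds f))"
  have "G \<le> F" by (simp add: G_def)
  have "G \<noteq> bot"
  proof
    assume "G = bot"
    then have "eventually (\<lambda>_. False) G" by simp
    then obtain P Q where P: "eventually P F" and Q: "eventually Q (nhds f)"
      and PQ: "\<And>i. P i \<Longrightarrow> Q (\<phi> i) \<Longrightarrow> False"
      unfolding G_def eventually_inf eventually_filtercomap by metis
    have "eventually (\<lambda>g. \<not> Q g) (filtermap \<phi> F)"
      unfolding eventually_filtermap using P by (rule eventually_mono) (use PQ in blast)
    with Q have "eventually (\<lambda>_. False) (inf (nhds f) (filtermap \<phi> F))"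
      unfolding eventually_inf by blast
    with nt show False by (simp add: trivial_limit_def)
  qed
  have "filterlim \<phi> (nhds f) G"
    unfolding G_def by (meson filterlim_filtercomap filterlim_mono inf_le2 order_refl)
  then have lim: "((\<lambda>i. inner (X i) h) \<longlongrightarrow> f h) G" for h
    using continuous_on_tendsto_compose[where f = "\<lambda>g::'a \<Rightarrow> real. g h" and s = UNIV and g = \<phi>]
    by (simp add: \<phi>_def)
  have "bounded_linear f"
  proof (rule bounded_linear_intro)
    show "f (h + h') = f h + f h'" for h h'
      using tendsto_unique[OF \<open>G \<noteq> bot\<close> lim[of "h + h'"]] tendsto_add[OF lim[of h] lim[of h']]
      by (simp add: inner_add_right)
    show "f (r *\<^sub>R h) = r *\<^sub>R f h" for r h
      using tendsto_unique[OF \<open>G \<noteq> bot\<close> lim[of "r *\<^sub>R h"]] tendsto_mult_left[OF lim[of h], of r]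
      by simp
    show "norm (f h) \<le> norm h * M" for h
      using f by (auto simp: K_def PiE_iff abs_le_iff mult.commute) (metis minus_le_iff)
  qed
  then obtain p where "\<And>h. f h = inner p h" by (rule riesz_representation_inner) auto
  with lim \<open>G \<le> F\<close> \<open>G \<noteq> bot\<close> show thesis using that by metis
qed

text \<open>For two cluster points \<open>p\<close>, \<open>q\<close> in \<open>S\<close>, the difference
  \<open>\<parallel>X\<^sub>k - q\<parallel>\<^sup>2 - \<parallel>X\<^sub>k - p\<parallel>\<^sup>2\<close> is affine in \<open>\<langle>X\<^sub>k, p - q\<rangle>\<close>, which therefore converges.  Its limits
  \<open>\<langle>p, p - q\<rangle>\<close> and \<open>\<langle>q, p - q\<rangle>\<close> along the two filters must agree, so \<open>p = q\<close>; a bounded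
  sequence with a single weak cluster point converges weakly.\<close>

lemma opial:
  fixes X :: "nat \<Rightarrow> 'a::{real_inner, complete_space}"
  assumes ne: "S \<noteq> {}"
    and conv: "\<And>s. s \<in> S \<Longrightarrow> convergent (\<lambda>k. norm (X k - s))"
    and cluster: "\<And>F p. F \<noteq> bot \<Longrightarrow> F \<le> sequentially \<Longrightarrow>
      (\<And>h. ((\<lambda>k. inner (X k) h) \<longlongrightarrow> inner p h) F) \<Longrightarrow> p \<in> S"
  obtains p where "p \<in> S" "weakly_converges X p"
proof -
  obtain s where s: "s \<in> S" using ne by blast
  obtain C where C: "\<And>k. norm (X k - s) \<le> C"
    using convergent_imp_Bseq[OF conv[OF s]] by (auto simp: Bseq_def)
  have bnd: "norm (X k) \<le> C + norm s" for k
    using C[of k] norm_triangle_sub[of "X k" s] by linarith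
  have uniq: "p = q"
    if F: "F \<noteq> bot" "F \<le> sequentially" "\<And>h. ((\<lambda>k. inner (X k) h) \<longlongrightarrow> inner p h) F"
      and G: "G \<noteq> bot" "G \<le> sequentially" "\<And>h. ((\<lambda>k. inner (X k) h) \<longlongrightarrow> inner q h) G"
    for F G p q
  proof -
    have pq: "p \<in> S" "q \<in> S" using cluster F G by auto
    then obtain P Q where "(\<lambda>k. norm (X k - p)) \<longlonglongrightarrow> P" "(\<lambda>k. norm (X k - q)) \<longlonglongrightarrow> Q"
      using conv by (meson convergentD)
    then have "(\<lambda>k. ((norm (X k - q))\<^sup>2 - (norm (X k - p))\<^sup>2 + (norm p)\<^sup>2 - (norm q)\<^sup>2) / 2)
        \<longlonglongrightarrow> (Q\<^sup>2 - P\<^sup>2 + (norm p)\<^sup>2 - (norm q)\<^sup>2) / 2" (is "_ \<longlonglongrightarrow> ?L")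
      by (intro tendsto_intros) simp_all
    moreover have "((norm (X k - q))\<^sup>2 - (norm (X k - p))\<^sup>2 + (norm p)\<^sup>2 - (norm q)\<^sup>2) / 2
        = inner (X k) (p - q)" for k
      by (simp add: power2_norm_eq_inner inner_simps inner_commute)
    ultimately have L: "(\<lambda>k. inner (X k) (p - q)) \<longlonglongrightarrow> ?L"
      by simp
    have "inner p (p - q) = ?L"
      using tendsto_unique[OF F(1) F(3) tendsto_mono[OF F(2) L]] .
    moreover have "inner q (p - q) = ?L"
      using tendsto_unique[OF G(1) G(3) tendsto_mono[OF G(2) L]] .
    ultimately have "inner (p - q) (p - q) = 0" by (simp add: inner_diff_left)
    then show ?thesis by simp
  qed
  obtain F p where F: "F \<le> sequentially" "F \<noteq> bot" "\<And>h. ((\<lambda>k. inner (X k) h) \<longlongrightarrow> inner p h) F"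
    using bounded_imp_weakly_convergent_subfilter[of sequentially X, OF _ bnd] by auto
  have "(\<lambda>k. inner (X k) h) \<longlonglongrightarrow> inner p h" for h
  proof (rule ccontr)
    assume "\<not> ?thesis"
    then obtain U where U: "open U" "inner p h \<in> U"
      and "\<not> eventually (\<lambda>k. inner (X k) h \<in> U) sequentially"
      unfolding tendsto_def by blast
    \<comment> \<open>A cluster point along the indices that stay outside \<open>U\<close> must again be \<open>p\<close>.\<close>
    then have nb: "inf sequentially (principal {k. inner (X k) h \<notin> U}) \<noteq> bot"
      by (simp add: trivial_limit_def eventually_inf_principal)
    obtain G q where G: "G \<le> inf sequentially (principal {k. inner (X k) h \<notin> U})" "G \<noteq> bot"
        "\<And>h. ((\<lambda>k. inner (X k) h) \<longlongrightarrow> inner q h) G"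
      using bounded_imp_weakly_convergent_subfilter[of _ X, OF nb bnd] by blast
    have "G \<le> sequentially" using G(1) by simp
    then have "q = p" using uniq[OF G(2) _ G(3) F(2) F(1) F(3)] by blast
    then have "eventually (\<lambda>k. inner (X k) h \<in> U) G"
      using G(3)[of h] U topological_tendstoD by blast
    moreover have "eventually (\<lambda>k. inner (X k) h \<notin> U) G"
      by (rule filter_leD[OF G(1)]) (simp add: eventually_inf_principal)
    ultimately have "eventually (\<lambda>_. False) G" by eventually_elim simp
    with G(2) show False by (simp add: trivial_limit_def)
  qed
  then show thesis using that[of p] cluster F by (simp add: weakly_converges_def)
qed

section \<open>Weak closedness for a pair of maximal monotone operators\<close>

lemma maximal_monotone_memI:
  assumes T: "maximal_monotone T"
    and pq: "\<And>u v. v \<in> T u \<Longrightarrow> inner (p - u) (q - v) \<ge> 0"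
  shows "q \<in> T p"
proof -
  define S where "S = T(p := insert q (T p))"
  have mono: "v \<in> T z \<Longrightarrow> v' \<in> T z' \<Longrightarrow> inner (z - z') (v - v') \<ge> 0" for z z' v v'
    using T unfolding maximal_monotone_def monotone_operator_def by blast
  have pq': "inner (u - p) (v - q) \<ge> 0" if "v \<in> T u" for u v
    using pq[OF that] by (simp add: inner_simps algebra_simps)
  have "monotone_operator S"
    unfolding monotone_operator_def S_def
    using mono pq pq' by (auto split: if_splits)
  moreover have "\<forall>z. T z \<subseteq> S z" by (auto simp: S_def)
  ultimately have "S = T" using T unfolding maximal_monotone_def by blast
  then have "S p = T p" by simp
  then show ?thesis by (auto simp: S_def)
qed

text \<open>Separately, each inner product could a priori be negative.  If \<open>q \<notin> B p\<close>, some \<open>(u, v)\<close> in the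
  graph of \<open>B\<close> makes the first one negative, so the second is always strictly positive; then \<open>A\<close>
  contains \<open>(p, - q)\<close> by maximality, where the second one vanishes.  Once \<open>q \<in> B p\<close> is known,
  the first term can be made zero.\<close>

lemma maximal_monotone_pair_memI:
  assumes A: "maximal_monotone A" and B: "maximal_monotone B"
    and sum: "\<And>u v u' v'. v \<in> B u \<Longrightarrow> v' \<in> A u' \<Longrightarrow>
      inner (p - u) (q - v) + inner (p - u') (- q - v') \<ge> 0"
  shows "(p, q) \<in> extended_solution_set A B"
proof -
  have "q \<in> B p"
  proof (rule ccontr)
    assume "q \<notin> B p"
    then obtain u v where uv: "v \<in> B u" "inner (p - u) (q - v) < 0"
      using maximal_monotone_memI[OF B] by (meson not_le)
    then have pos: "inner (p - u') (- q - v') > 0" if "v' \<in> A u'" for u' v'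
      using sum[OF uv(1) that] by linarith
    then have "- q \<in> A p" by (intro maximal_monotone_memI[OF A] less_imp_le)
    from pos[OF this] show False by simp
  qed
  moreover have "- q \<in> A p"
    using sum[OF \<open>q \<in> B p\<close>] by (intro maximal_monotone_memI[OF A]) simp
  ultimately show ?thesis by (simp add: extended_solution_set_def)
qed

lemma tendsto_inner_zero_bounded:
  fixes X Y :: "'i \<Rightarrow> 'a::real_inner"
  assumes X: "(X \<longlongrightarrow> 0) F" and Y: "\<And>i. norm (Y i) \<le> M"
  shows "((\<lambda>i. inner (X i) (Y i)) \<longlongrightarrow> 0) F"
proof (rule Lim_null_comparison)
  have "norm (inner (X i) (Y i)) \<le> norm (X i) * M" for i
    using Cauchy_Schwarz_ineq2[of "X i" "Y i"] Y[of i]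
    by (metis mult_left_mono norm_ge_zero order_trans real_norm_def)
  then show "\<forall>\<^sub>F i in F. norm (inner (X i) (Y i)) \<le> norm (X i) * M" by simp
  show "((\<lambda>i. norm (X i) * M) \<longlongrightarrow> 0) F"
    using tendsto_mult_right[OF tendsto_norm[OF X], of M] by simp
qed

text \<open>The product \<open>\<langle>x\<^sub>i, b\<^sub>i\<rangle>\<close> of two weakly convergent families need not converge.  Adding the
  inequalities for \<open>A\<close> and \<open>B\<close> removes it, because
  \<open>\<langle>x\<^sub>i, b\<^sub>i\<rangle> + \<langle>y\<^sub>i, a\<^sub>i\<rangle> = \<langle>a\<^sub>i + b\<^sub>i, y\<^sub>i\<rangle> - \<langle>y\<^sub>i - x\<^sub>i, b\<^sub>i\<rangle>\<close> is a product of null families with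
  bounded ones.\<close>

lemma weak_cluster_in_extended_solution_set:
  fixes x b y a :: "'i \<Rightarrow> 'a::real_inner"
  assumes A: "maximal_monotone A" and B: "maximal_monotone B"
    and F: "F \<noteq> bot"
    and enl: "eventually (\<lambda>i. b i \<in> enlargement B (\<mu> i) (x i)) F"
    and grA: "eventually (\<lambda>i. a i \<in> A (y i)) F"
    and \<mu>: "(\<mu> \<longlongrightarrow> 0) F"
    and xy: "((\<lambda>i. y i - x i) \<longlongrightarrow> 0) F" and ab: "((\<lambda>i. a i + b i) \<longlongrightarrow> 0) F"
    and x: "\<And>h. ((\<lambda>i. inner (x i) h) \<longlongrightarrow> inner p h) F"
    and b: "\<And>h. ((\<lambda>i. inner (b i) h) \<longlongrightarrow> inner q h) F"
    and bnd: "\<And>i. norm (y i) \<le> M" "\<And>i. norm (b i) \<le> M"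
  shows "(p, q) \<in> extended_solution_set A B"
proof (rule maximal_monotone_pair_memI[OF A B])
  fix u v u' v' assume uv: "v \<in> B u" "v' \<in> A u'"
  \<comment> \<open>\<open>E - R\<close> is the sum of the two monotonicity inequalities; \<open>R\<close> collects what tends to zero and
    \<open>E\<close> is affine in \<open>x\<close> and \<open>b\<close> separately.\<close>
  define R where "R i = inner (y i - x i) (b i) - inner (a i + b i) (y i)
    + inner (y i - x i) v' + inner (a i + b i) u' - \<mu> i" for i
  define E where "E i = inner (u' - u) (b i) - inner (x i) (v + v') + inner u v + inner u' v'" for i
  have "(R \<longlongrightarrow> 0 - 0 + inner 0 v' + inner 0 u' - 0) F"
    unfolding R_def
    by (intro tendsto_intros tendsto_inner_zero_bounded[OF xy bnd(2)]
        tendsto_inner_zero_bounded[OF ab bnd(1)] xy ab \<mu>)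
  moreover have "(E \<longlongrightarrow> inner q (u' - u) - inner p (v + v') + inner u v + inner u' v') F"
    unfolding E_def inner_commute[of "u' - u"] by (intro tendsto_intros x b)
  ultimately have "((\<lambda>i. E i - R i) \<longlongrightarrow>
      inner q (u' - u) - inner p (v + v') + inner u v + inner u' v' - 0) F"
    by (intro tendsto_diff) simp_all
  moreover have "eventually (\<lambda>i. 0 \<le> E i - R i) F"
    using enl grA
  proof eventually_elim
    case (elim i)
    have "inner (x i - u) (b i - v) \<ge> - \<mu> i" 
      using elim(1) uv(1) by (auto simp: enlargement_def)
    moreover have "inner (y i - u') (a i - v') \<ge> 0"
      using A elim(2) uv(2) by (auto simp: maximal_monotone_def monotone_operator_def)
    moreover have "E i - R i = inner (x i - u) (b i - v) + inner (y i - u') (a i - v') + \<mu> i"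
      by (simp add: E_def R_def inner_simps inner_commute algebra_simps)
    ultimately show ?case by linarith
  qed
  ultimately have "0 \<le> inner q (u' - u) - inner p (v + v') + inner u v + inner u' v' - 0"
    by (rule tendsto_lowerbound[OF _ _ F])
  then show "0 \<le> inner (p - u) (q - v) + inner (p - u') (- q - v')"
    by (simp add: inner_simps inner_commute algebra_simps)
qed

section \<open>Null sequences and weak limits\<close>

lemma tendsto_zero_mult_le:
  fixes f g :: "'i \<Rightarrow> real"
  assumes "\<And>i. 0 \<le> f i" and "\<And>i. c * f i \<le> g i" and "0 < c" and g: "(g \<longlongrightarrow> 0) F"
  shows "(f \<longlongrightarrow> 0) F"
proof (rule Lim_null_comparison[OF always_eventually])
  show "\<forall>i. norm (f i) \<le> g i / c"
    using assms(1-3) by (simp add: pos_le_divide_eq mult.commute)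
  show "((\<lambda>i. g i / c) \<longlongrightarrow> 0) F" using g by (rule tendsto_divide_zero)
qed

lemma tendsto_zero_norm_square_le:
  fixes X :: "'i \<Rightarrow> 'a::real_normed_vector"
  assumes "\<And>i. (norm (X i))\<^sup>2 \<le> g i" and g: "(g \<longlongrightarrow> 0) F"
  shows "(X \<longlongrightarrow> 0) F"
proof (rule Lim_null_comparison)
  show "\<forall>\<^sub>F i in F. norm (X i) \<le> sqrt (g i)"
    using assms(1) by (simp add: real_le_rsqrt)
  show "((\<lambda>i. sqrt (g i)) \<longlongrightarrow> 0) F"
    using tendsto_real_sqrt[OF g] by simp
qed

lemma weak_tendsto_perturb:
  fixes X Y :: "'i \<Rightarrow> 'a::real_inner"
  assumes "\<And>h. ((\<lambda>i. inner (X i) h) \<longlongrightarrow> inner p h) F" and "((\<lambda>i. Y i - X i) \<longlongrightarrow> 0) F"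
  shows "((\<lambda>i. inner (Y i) h) \<longlongrightarrow> inner p h) F"
  using tendsto_add[OF assms(1)[of h] tendsto_inner[OF assms(2) tendsto_const[of h]]]
  by (simp add: inner_diff_left)

lemma norm_le_of_null_difference:
  fixes X Y :: "nat \<Rightarrow> 'a::real_normed_vector"
  assumes X: "\<And>n. norm (X n) \<le> K" and diff: "(\<lambda>n. Y n - X n) \<longlonglongrightarrow> 0"
  shows "\<exists>K'. \<forall>n. norm (Y n) \<le> K'"
proof -
  obtain C where C: "\<And>n. norm (Y n - X n) \<le> C"
    using convergent_imp_Bseq[OF convergentI[OF diff]] by (auto simp: Bseq_def)
  have "norm (Y n) \<le> K + C" for n
    using norm_triangle_sub[of "Y n" "X n"] X[of n] C[of n] by linarith
  then show ?thesis by blast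
qed

section \<open>One step of the algorithm\<close>

text \<open>The identity for \<open>t \<rho>\<close> clears the denominators in the definition of \<open>t\<close>.  It survives the
  degenerate case \<open>\<rho> = 0\<close>, where \<open>t\<close> is set to zero, because then the error criterion forces
  \<open>\<delta> \<le> 0\<close> and the maximum vanishes.\<close>

lemma dr_t_bounds:
  fixes w a y b x :: "'a::real_inner"
  assumes l: "l > 0" and \<sigma>: "0 < \<sigma>" "\<sigma> < \<nu>" "\<nu> < 1" and \<mu>: "\<mu> \<ge> 0"
    and err: "dr_delta l w y b x \<mu> \<le> \<sigma>\<^sup>2 * dr_rho l a y b x"
  shows "0 \<le> dr_t l \<sigma> \<nu> w a y b x \<mu>"
    and "dr_t l \<sigma> \<nu> w a y b x \<mu> \<le> \<nu>\<^sup>2"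
    and "dr_t l \<sigma> \<nu> w a y b x \<mu> * dr_rho l a y b x =
      \<nu>\<^sup>2 * max 0 (dr_delta l w y b x \<mu> / \<sigma>\<^sup>2 - (norm (l *\<^sub>R (a + w)))\<^sup>2)"
proof -
  define t \<delta> \<rho> s where "t = dr_t l \<sigma> \<nu> w a y b x \<mu>" and "\<delta> = dr_delta l w y b x \<mu>"
    and "\<rho> = dr_rho l a y b x" and "s = (norm (l *\<^sub>R (a + w)))\<^sup>2"
  have \<rho>: "0 \<le> \<rho>" "0 \<le> s" by (simp_all add: \<rho>_def dr_rho_def s_def)
  have \<rho>0: "\<rho> = 0 \<longleftrightarrow> a + b = 0 \<and> x - y = 0"
    using l by (simp add: \<rho>_def dr_rho_def add_nonneg_eq_0_iff)
  have t: "t = (if \<rho> = 0 then 0 else \<nu>\<^sup>2 * max 0 (\<delta> / (\<sigma>\<^sup>2 * \<rho>) - s / \<rho>))"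
    unfolding \<rho>0 unfolding t_def dr_t_def \<delta>_def \<rho>_def s_def by (rule refl)
  have err': "\<delta> / \<sigma>\<^sup>2 \<le> \<rho>"
    using err \<sigma> by (simp add: \<delta>_def \<rho>_def divide_le_eq mult.commute)
  show "0 \<le> t" by (simp add: t)
  have "\<delta> / (\<sigma>\<^sup>2 * \<rho>) \<le> 1" "0 \<le> s / \<rho>" if "\<rho> \<noteq> 0"
    using that \<rho> err \<sigma> by (simp_all add: \<delta>_def \<rho>_def divide_le_eq)
  then have "max 0 (\<delta> / (\<sigma>\<^sup>2 * \<rho>) - s / \<rho>) \<le> 1" if "\<rho> \<noteq> 0"
    using that by fastforce
  then show "t \<le> \<nu>\<^sup>2" by (simp add: t mult_left_le)
  show "t * \<rho> = \<nu>\<^sup>2 * max 0 (\<delta> / \<sigma>\<^sup>2 - s)"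
  proof (cases "\<rho> = 0")
    case True
    then have "\<delta> / \<sigma>\<^sup>2 - s \<le> 0" using err' \<rho> by linarith
    then show ?thesis using True by simp
  next
    case False
    then have "0 < \<rho>" using \<rho> by simp
    then have "max 0 (\<delta> / (\<sigma>\<^sup>2 * \<rho>) - s / \<rho>) * \<rho> = max 0 (\<delta> / \<sigma>\<^sup>2 - s)"
      by (simp add: max_mult_distrib_right left_diff_distrib)
    with False show ?thesis by (simp add: t)
  qed
qed

text \<open>The descent is that of a relaxed projection.  With \<open>c = l (a + b)\<close> and \<open>d = x - y\<close>, the point
  \<open>(z, l w)\<close> moves by \<open>- (1 - t) (c, d)\<close>, and \<open>\<parallel>(c, d)\<parallel>\<^sup>2 = \<rho>\<close>.  The inner product \<open>G\<close> of
  the deviation from the solution with \<open>(c, d)\<close> splits into \<open>l\<close> times the two monotonicity terms,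
  together at least \<open>- l \<mu>\<close>, and a remainder that the resolvent equation
  \<open>l a + y = z - l w\<close> evaluates to \<open>(\<rho> + \<parallel>s\<parallel>\<^sup>2 - \<parallel>e\<parallel>\<^sup>2) / 2\<close>, where \<open>s = l (a + w)\<close> and
  \<open>e = l b + x - (y + l w)\<close>.\<close>

lemma fejer_step:
  fixes A B :: "'a::real_inner \<Rightarrow> 'a set"
  assumes A: "monotone_operator A" and l: "l > 0"
    and sol: "(p, q) \<in> extended_solution_set A B"
    and a: "a \<in> A y" and res: "l *\<^sub>R a + y = z - l *\<^sub>R w"
    and b: "b \<in> enlargement B \<mu> x"
    and t: "t \<le> 1"
    and z': "z' = z - ((1 - t) * l) *\<^sub>R (a + b)"
    and w': "w' = w - ((1 - t) * inverse l) *\<^sub>R (x - y)"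
  shows "(norm ((z', l *\<^sub>R w') - (p, l *\<^sub>R q)))\<^sup>2 \<le> (norm ((z, l *\<^sub>R w) - (p, l *\<^sub>R q)))\<^sup>2
    - (1 - t) * (t * dr_rho l a y b x + (norm (l *\<^sub>R (a + w)))\<^sup>2 - dr_delta l w y b x \<mu>)"
proof -
  define c d where "c = l *\<^sub>R (a + b)" and "d = x - y"
  define G where "G = inner (z - p) c + inner (l *\<^sub>R (w - q)) d"
  have z: "z = l *\<^sub>R a + y + l *\<^sub>R w" using res by (simp add: algebra_simps)
  have "G = l * (inner (x - p) (b - q) + inner (y - p) (a + q))
      + (dr_rho l a y b x + (norm (l *\<^sub>R (a + w)))\<^sup>2 - (norm (l *\<^sub>R b + x - (y + l *\<^sub>R w)))\<^sup>2) / 2"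
    unfolding G_def c_def d_def z dr_rho_def power2_norm_eq_inner
    by (simp add: inner_simps inner_commute field_simps)
  moreover have "inner (x - p) (b - q) \<ge> - \<mu>"
    using b sol by (auto simp: enlargement_def extended_solution_set_def)
  moreover have "inner (y - p) (a + q) \<ge> 0"
    using A a sol unfolding monotone_operator_def extended_solution_set_def by fastforce
  moreover from calculation(2,3) have
    "l * (inner (x - p) (b - q) + inner (y - p) (a + q)) \<ge> l * - \<mu>"
    using l by (intro mult_left_mono) auto
  ultimately have G: "2 * G \<ge> dr_rho l a y b x + (norm (l *\<^sub>R (a + w)))\<^sup>2 - dr_delta l w y b x \<mu>"
    unfolding dr_delta_def by argo
  have "(norm ((z', l *\<^sub>R w') - (p, l *\<^sub>R q)))\<^sup>2
      = (norm (z - p - (1 - t) *\<^sub>R c))\<^sup>2 + (norm (l *\<^sub>R (w - q) - (1 - t) *\<^sub>R d))\<^sup>2"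
  proof -
    have "z' - p = z - p - (1 - t) *\<^sub>R c" by (simp add: z' c_def)
    moreover have "l *\<^sub>R w' - l *\<^sub>R q = l *\<^sub>R (w - q) - (1 - t) *\<^sub>R d"
    proof -
      have "l * ((1 - t) * inverse l) = 1 - t" using l by simp
      then show ?thesis by (simp only: w' d_def scaleR_diff_right scaleR_scaleR) simp
    qed
    ultimately have "(z', l *\<^sub>R w') - (p, l *\<^sub>R q)
        = (z - p - (1 - t) *\<^sub>R c, l *\<^sub>R (w - q) - (1 - t) *\<^sub>R d)"
      by (simp only: diff_Pair)
    then show ?thesis by (simp only: norm_Pair) simp
  qed
  also have "\<dots> = (norm (z - p))\<^sup>2 + (norm (l *\<^sub>R (w - q)))\<^sup>2 - (1 - t) * (2 * G)
      + (1 - t)\<^sup>2 * dr_rho l a y b x"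
    unfolding G_def dr_rho_def c_def[symmetric] d_def[symmetric] power2_norm_eq_inner
    by (simp add: inner_simps inner_commute algebra_simps power2_eq_square)
  also have "(norm (z - p))\<^sup>2 + (norm (l *\<^sub>R (w - q)))\<^sup>2 = (norm ((z, l *\<^sub>R w) - (p, l *\<^sub>R q)))\<^sup>2"
    by (simp add: norm_Pair scaleR_diff_right)
  finally have eq: "(norm ((z', l *\<^sub>R w') - (p, l *\<^sub>R q)))\<^sup>2 = (norm ((z, l *\<^sub>R w) - (p, l *\<^sub>R q)))\<^sup>2
      - (1 - t) * (2 * G) + (1 - t)\<^sup>2 * dr_rho l a y b x" .
  have "(1 - t) * (2 * G)
      \<ge> (1 - t) * (dr_rho l a y b x + (norm (l *\<^sub>R (a + w)))\<^sup>2 - dr_delta l w y b x \<mu>)"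
    using G t by (intro mult_left_mono) auto
  with eq show ?thesis by (simp add: algebra_simps power2_eq_square)
qed

section \<open>Weak convergence of the algorithm\<close>

theorem theorem4p3:
  fixes A B :: "'a::{real_inner, complete_space} \<Rightarrow> 'a set"
    and l \<sigma> \<nu> :: real
    and z w a y b x :: "nat \<Rightarrow> 'a"
    and \<mu> :: "nat \<Rightarrow> real"
  assumes "maximal_monotone A" and "maximal_monotone B"
    and "l > 0" and "0 < \<sigma>" and "\<sigma> < \<nu>" and "\<nu> < 1"
    and "semi_inexact_DR A B l \<sigma> \<nu> z w a y b x \<mu>"
    and "extended_solution_set A B \<noteq> {}"
  shows "\<exists>p \<in> extended_solution_set A B.
           weakly_converges (\<lambda>k. (x k, b k)) p \<and>
           weakly_converges (\<lambda>k. (y k, - a k)) p \<and>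
           weakly_converges (\<lambda>k. (z k, w k)) p"
proof -
  \<comment> \<open>Index \<open>n\<close> refers to step \<open>n + 1\<close>, which starts from \<open>(z\<^sub>n, w\<^sub>n)\<close>.\<close>
  define \<delta> \<rho> t where "\<delta> n = dr_delta l (w n) (y (Suc n)) (b (Suc n)) (x (Suc n)) (\<mu> (Suc n))"
    and "\<rho> n = dr_rho l (a (Suc n)) (y (Suc n)) (b (Suc n)) (x (Suc n))"
    and "t n = dr_t l \<sigma> \<nu> (w n) (a (Suc n)) (y (Suc n)) (b (Suc n)) (x (Suc n)) (\<mu> (Suc n))" for n
  define s e d where "s n = l *\<^sub>R (a (Suc n) + w n)"
    and "e n = l *\<^sub>R b (Suc n) + x (Suc n) - (y (Suc n) + l *\<^sub>R w n)"
    and "d n = x (Suc n) - y (Suc n)" for n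
  have alg:
    "a (Suc n) \<in> A (y (Suc n))"
    "l *\<^sub>R a (Suc n) + y (Suc n) = z n - l *\<^sub>R w n"
    "0 \<le> \<mu> (Suc n)"
    "b (Suc n) \<in> enlargement B (\<mu> (Suc n)) (x (Suc n))"
    "\<delta> n \<le> \<sigma>\<^sup>2 * \<rho> n"
    "z (Suc n) = z n - ((1 - t n) * l) *\<^sub>R (a (Suc n) + b (Suc n))"
    "w (Suc n) = w n - ((1 - t n) * inverse l) *\<^sub>R (x (Suc n) - y (Suc n))" for n
    using assms(7)[unfolded semi_inexact_DR_def, rule_format, of "Suc n"]
    by (simp_all add: \<delta>_def \<rho>_def t_def Let_def)
  note A = \<open>maximal_monotone A\<close> and B = \<open>maximal_monotone B\<close> and l = \<open>l > 0\<close>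
    and \<sigma> = \<open>0 < \<sigma>\<close> \<open>\<sigma> < \<nu>\<close> \<open>\<nu> < 1\<close>
  have t: "0 \<le> t n" "t n \<le> \<nu>\<^sup>2" "t n * \<rho> n = \<nu>\<^sup>2 * max 0 (\<delta> n / \<sigma>\<^sup>2 - (norm (s n))\<^sup>2)" for n
    using dr_t_bounds[OF l \<sigma> alg(3) alg(5)[unfolded \<delta>_def \<rho>_def]]
    by (simp_all add: t_def \<delta>_def \<rho>_def s_def)
  have \<nu>2: "\<nu>\<^sup>2 < 1" using \<sigma> by (simp add: power_less_one_iff)
  have \<sigma>\<nu>: "1 < \<nu>\<^sup>2 / \<sigma>\<^sup>2" using \<sigma> by (simp add: power_strict_mono)
  have t1: "t n \<le> 1" for n using t(2)[of n] \<nu>2 by linarith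
  have \<delta>0: "0 \<le> \<delta> n" and e_le: "(norm (e n))\<^sup>2 \<le> \<delta> n" and \<mu>_le: "2 * l * \<mu> (Suc n) \<le> \<delta> n" for n
    using alg(3)[of n] l by (simp_all add: \<delta>_def dr_delta_def e_def)
  \<comment> \<open>The scaling by \<open>l\<close> turns the product norm into the one for which the iteration is Fejer
    monotone.\<close>
  define R where "R n = (z n, l *\<^sub>R w n)" for n
  define S where "S = (\<lambda>(p, q). (p, l *\<^sub>R q)) ` extended_solution_set A B"
  \<comment> \<open>A lower bound for the second factor of the descent; both coefficients are positive since
    \<open>\<sigma> < \<nu> < 1\<close>.\<close>
  define g where "g n = (\<nu>\<^sup>2 / \<sigma>\<^sup>2 - 1) * \<delta> n + (1 - \<nu>\<^sup>2) * (norm (s n))\<^sup>2" for n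
  have g0: "0 \<le> g n" for n
    using \<delta>0[of n] \<nu>2 \<sigma>\<nu> by (simp add: g_def)
  have step: "(norm (R (Suc n) - P))\<^sup>2 + (1 - \<nu>\<^sup>2) * g n \<le> (norm (R n - P))\<^sup>2" if "P \<in> S" for P n
  proof -
    obtain p q where pq: "(p, q) \<in> extended_solution_set A B" "P = (p, l *\<^sub>R q)"
      using \<open>P \<in> S\<close> by (auto simp: S_def)
    have "(norm (R (Suc n) - P))\<^sup>2 \<le>
        (norm (R n - P))\<^sup>2 - (1 - t n) * (t n * \<rho> n + (norm (s n))\<^sup>2 - \<delta> n)"
      unfolding R_def pq(2) s_def \<rho>_def \<delta>_def
      using A pq(1) alg t1
      by (intro fejer_step[OF _ l]) (auto simp: maximal_monotone_def)
    moreover have "g n \<le> t n * \<rho> n + (norm (s n))\<^sup>2 - \<delta> n"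
    proof -
      \<comment> \<open>Bounding the maximum below by its second argument treats \<open>t = 0\<close> and \<open>t > 0\<close> at once.\<close>
      have "\<nu>\<^sup>2 * (\<delta> n / \<sigma>\<^sup>2 - (norm (s n))\<^sup>2) \<le> t n * \<rho> n"
        unfolding t(3) by (intro mult_left_mono) auto
      then show ?thesis by (simp add: g_def algebra_simps)
    qed
    then have "(1 - \<nu>\<^sup>2) * g n \<le> (1 - t n) * (t n * \<rho> n + (norm (s n))\<^sup>2 - \<delta> n)"
      using t(2)[of n] t1[of n] g0[of n] by (intro mult_mono) auto
    ultimately show ?thesis by linarith
  qed
  have dec: "norm (R (Suc n) - P) \<le> norm (R n - P)" if "P \<in> S" for P n
  proof -
    have "0 \<le> (1 - \<nu>\<^sup>2) * g n" using g0[of n] \<nu>2 by simp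
    then have "(norm (R (Suc n) - P))\<^sup>2 \<le> (norm (R n - P))\<^sup>2"
      using step[OF that, of n] by linarith
    then show ?thesis by (rule power2_le_imp_le) simp
  qed
  have conv: "convergent (\<lambda>n. norm (R n - P))" if "P \<in> S" for P
  proof (rule Bseq_monoseq_convergent)
    have "decseq (\<lambda>n. norm (R n - P))" by (rule decseq_SucI) (rule dec[OF that])
    then show "monoseq (\<lambda>n. norm (R n - P))" "Bseq (\<lambda>n. norm (R n - P))"
      by (auto simp: monoseq_iff intro: decseq_bounded[where B = 0])
  qed
  obtain P where P: "P \<in> S" using assms(8) unfolding S_def by blast
  have g: "g \<longlonglongrightarrow> 0"
  proof (rule tendsto_zero_mult_le)
    obtain D where D: "(\<lambda>n. norm (R n - P)) \<longlonglongrightarrow> D"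
      using conv[OF P] unfolding convergent_def by blast
    have "(\<lambda>n. (norm (R n - P))\<^sup>2 - (norm (R (Suc n) - P))\<^sup>2) \<longlonglongrightarrow> D\<^sup>2 - D\<^sup>2"
      by (intro tendsto_intros D LIMSEQ_Suc[OF D])
    then show "(\<lambda>n. (norm (R n - P))\<^sup>2 - (norm (R (Suc n) - P))\<^sup>2) \<longlonglongrightarrow> 0" by simp
    show "(1 - \<nu>\<^sup>2) * g n \<le> (norm (R n - P))\<^sup>2 - (norm (R (Suc n) - P))\<^sup>2" for n
      using step[OF P, of n] by linarith
  qed (use g0 \<nu>2 in auto)
  have \<delta>: "\<delta> \<longlonglongrightarrow> 0"
  proof (rule tendsto_zero_mult_le[OF _ _ _ g])
    show "(\<nu>\<^sup>2 / \<sigma>\<^sup>2 - 1) * \<delta> n \<le> g n" for n using \<nu>2 by (simp add: g_def)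
    show "0 < \<nu>\<^sup>2 / \<sigma>\<^sup>2 - 1" using \<sigma>\<nu> by linarith
  qed (rule \<delta>0)
  have "(\<lambda>n. (norm (s n))\<^sup>2) \<longlonglongrightarrow> 0"
  proof (rule tendsto_zero_mult_le[OF _ _ _ g])
    have "0 \<le> (\<nu>\<^sup>2 / \<sigma>\<^sup>2 - 1) * \<delta> n" for n
      using \<sigma>\<nu> \<delta>0[of n] by (intro mult_nonneg_nonneg) linarith+
    then show "(1 - \<nu>\<^sup>2) * (norm (s n))\<^sup>2 \<le> g n" for n by (simp add: g_def)
    show "0 < 1 - \<nu>\<^sup>2" using \<nu>2 by linarith
  qed simp
  then have s: "s \<longlonglongrightarrow> 0" by (rule tendsto_zero_norm_square_le[OF order_refl])
  have e: "e \<longlonglongrightarrow> 0" using e_le \<delta> by (rule tendsto_zero_norm_square_le)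
  have \<mu>: "\<mu> \<longlonglongrightarrow> 0"
  proof (rule LIMSEQ_imp_Suc, rule tendsto_zero_mult_le[OF _ _ _ \<delta>])
    show "2 * l * \<mu> (Suc n) \<le> \<delta> n" for n by (rule \<mu>_le)
  qed (use alg(3) l in auto)
  \<comment> \<open>The descent gives no bound on \<open>d\<close> alone, but \<open>t\<^sup>2 \<parallel>d\<parallel>\<^sup>2 \<le> t \<rho>\<close>, and
    \<open>t \<rho>\<close> is at most \<open>\<nu>\<^sup>2 \<delta> / \<sigma>\<^sup>2\<close> by the choice of \<open>t\<close>.\<close>
  have td: "(\<lambda>n. t n *\<^sub>R d n) \<longlonglongrightarrow> 0"
  proof (rule tendsto_zero_norm_square_le)
    show "(\<lambda>n. \<nu>\<^sup>2 / \<sigma>\<^sup>2 * \<delta> n) \<longlonglongrightarrow> 0" using tendsto_mult_left[OF \<delta>, of "\<nu>\<^sup>2 / \<sigma>\<^sup>2"] by simp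
    fix n
    have "(norm (t n *\<^sub>R d n))\<^sup>2 = t n * (t n * (norm (d n))\<^sup>2)"
      by (simp add: power_mult_distrib power2_eq_square)
    also have "\<dots> \<le> 1 * (t n * \<rho> n)"
      using t(1)[of n] t1[of n] by (intro mult_mono) (auto simp: \<rho>_def dr_rho_def d_def)
    also have "\<dots> \<le> \<nu>\<^sup>2 * (\<delta> n / \<sigma>\<^sup>2)"
      unfolding t(3) mult_1 using \<delta>0[of n] by (intro mult_left_mono) auto
    finally show "(norm (t n *\<^sub>R d n))\<^sup>2 \<le> \<nu>\<^sup>2 / \<sigma>\<^sup>2 * \<delta> n" by simp
  qed
  have shrink: "(\<lambda>n. r n *\<^sub>R X n) \<longlonglongrightarrow> 0" if "X \<longlonglongrightarrow> 0" "\<And>n. 0 \<le> r n \<and> r n \<le> 1"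
    for r :: "nat \<Rightarrow> real" and X :: "nat \<Rightarrow> 'a"
  proof (rule Lim_null_comparison[OF always_eventually])
    show "(\<lambda>n. norm (X n)) \<longlonglongrightarrow> 0" using that(1) by (rule tendsto_norm_zero)
    show "\<forall>n. norm (r n *\<^sub>R X n) \<le> norm (X n)" using that(2) by (simp add: mult_left_le_one_le)
  qed
  have z_x: "(\<lambda>n. x n - z n) \<longlonglongrightarrow> 0"
  proof (rule LIMSEQ_imp_Suc)
    have "x (Suc n) - z (Suc n) = t n *\<^sub>R d n + (1 - t n) *\<^sub>R e n - t n *\<^sub>R s n" for n
    proof -
      have "z n = l *\<^sub>R a (Suc n) + y (Suc n) + l *\<^sub>R w n" using alg(2)[of n] by (simp add: algebra_simps)
      then show ?thesis unfolding alg(6) by (simp add: d_def e_def s_def algebra_simps)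
    qed
    moreover have "(\<lambda>n. t n *\<^sub>R d n + (1 - t n) *\<^sub>R e n - t n *\<^sub>R s n) \<longlonglongrightarrow> 0 + 0 - 0"
      using t(1) t1 by (intro tendsto_intros td shrink e s) auto
    ultimately show "(\<lambda>n. x (Suc n) - z (Suc n)) \<longlonglongrightarrow> 0" by simp
  qed
  have w_b: "(\<lambda>n. b n - w n) \<longlonglongrightarrow> 0"
  proof (rule LIMSEQ_imp_Suc)
    have "b (Suc n) - w (Suc n) = inverse l *\<^sub>R (e n - t n *\<^sub>R d n)" for n
      using l unfolding alg(7) by (simp add: d_def e_def algebra_simps)
    moreover have "(\<lambda>n. inverse l *\<^sub>R (e n - t n *\<^sub>R d n)) \<longlonglongrightarrow> inverse l *\<^sub>R (0 - 0)"
      by (intro tendsto_intros td e)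
    ultimately show "(\<lambda>n. b (Suc n) - w (Suc n)) \<longlonglongrightarrow> 0" by simp
  qed
  have z_y: "(\<lambda>n. y (Suc n) - z n) \<longlonglongrightarrow> 0"
  proof -
    have "y (Suc n) - z n = - s n" for n using alg(2)[of n] by (simp add: s_def algebra_simps)
    then show ?thesis using tendsto_minus[OF s] by simp
  qed
  have w_a: "(\<lambda>n. - a (Suc n) - w n) \<longlonglongrightarrow> 0"
  proof -
    have "- a (Suc n) - w n = - (inverse l *\<^sub>R s n)" for n using l by (simp add: s_def)
    then show ?thesis using tendsto_minus[OF tendsto_scaleR[OF tendsto_const s, of "inverse l"]] by simp
  qed
  have R: "Bseq R"
    using convergent_imp_Bseq[OF conv[OF P]] Bseq_add[of "\<lambda>n. R n - P" P] by (simp add: Bseq_def)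
  have unscale: "((\<lambda>k. inner (z k, w k) h) \<longlongrightarrow> inner (p, q) h) F"
    if "\<And>h. ((\<lambda>k. inner (R k) h) \<longlongrightarrow> inner (p, l *\<^sub>R q) h) F" for F p q h
  proof -
    have "inner (R k) (fst h, inverse l *\<^sub>R snd h) = inner (z k, w k) h"
      "inner (p, l *\<^sub>R q) (fst h, inverse l *\<^sub>R snd h) = inner (p, q) h" for k
      using l by (simp_all add: R_def inner_prod_def)
    with that[of "(fst h, inverse l *\<^sub>R snd h)"] show ?thesis by simp
  qed
  have cluster: "Q \<in> S"
    if F: "F \<noteq> bot" "F \<le> sequentially" "\<And>h. ((\<lambda>k. inner (R k) h) \<longlongrightarrow> inner Q h) F" for F Q
  proof -
    define p q where "p = fst Q" and "q = inverse l *\<^sub>R snd Q"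
    have Q: "Q = (p, l *\<^sub>R q)" using l by (simp add: p_def q_def)
    note zw = unscale[OF F(3)[unfolded Q]]
    have zp: "((\<lambda>k. inner (z k) h) \<longlongrightarrow> inner p h) F"
      and wq: "((\<lambda>k. inner (w k) h) \<longlongrightarrow> inner q h) F" for h
      using zw[of "(h, 0)"] zw[of "(0, h)"] by simp_all
    note mono = tendsto_mono[OF F(2)]
    obtain K where K: "\<And>n. norm (R n) \<le> K" using R by (auto simp: Bseq_def)
    have "norm (z n) \<le> K" for n
      using norm_fst_le[of "z n" "l *\<^sub>R w n"] K[of n] by (simp add: R_def)
    then obtain K1 where K1: "\<And>n. norm (y (Suc n)) \<le> K1"
      using norm_le_of_null_difference[OF _ z_y] by metis
    have "norm (w n) \<le> K / l" for n
      using norm_snd_le[of "l *\<^sub>R w n" "z n"] K[of n] l by (simp add: R_def field_simps)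
    then obtain K2 where K2: "\<And>n. norm (b n) \<le> K2"
      using norm_le_of_null_difference[OF _ w_b] by metis
    have pos: "eventually (\<lambda>k. 1 \<le> k) F"
      using filter_leD[OF F(2) eventually_ge_at_top] .
    \<comment> \<open>The point of \<open>B\<close> from step \<open>k\<close> is paired with the point of \<open>A\<close> from step \<open>k + 1\<close>:
      both are asymptotic to \<open>(z\<^sub>k, w\<^sub>k)\<close>.\<close>
    have "(p, q) \<in> extended_solution_set A B"
    proof (rule weak_cluster_in_extended_solution_set[OF A B F(1), of b \<mu> x "\<lambda>k. a (Suc k)" "\<lambda>k. y (Suc k)"])
      show "\<forall>\<^sub>F k in F. b k \<in> enlargement B (\<mu> k) (x k)"
        using pos by eventually_elim (metis alg(4) One_nat_def Suc_le_D)
      show "\<forall>\<^sub>F k in F. a (Suc k) \<in> A (y (Suc k))" using alg(1) by simp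
      show "(\<mu> \<longlongrightarrow> 0) F" using \<mu> by (rule mono)
      show "((\<lambda>k. y (Suc k) - x k) \<longlongrightarrow> 0) F"
        using mono[OF tendsto_diff[OF z_y z_x]] by simp
      show "((\<lambda>k. a (Suc k) + b k) \<longlongrightarrow> 0) F"
        using mono[OF tendsto_diff[OF w_b w_a]] by (simp add: add.commute)
      show "((\<lambda>k. inner (x k) h) \<longlongrightarrow> inner p h) F" for h
        by (rule weak_tendsto_perturb[OF zp mono[OF z_x]])
      show "((\<lambda>k. inner (b k) h) \<longlongrightarrow> inner q h) F" for h
        by (rule weak_tendsto_perturb[OF wq mono[OF w_b]])
      show "norm (y (Suc k)) \<le> max K1 K2" "norm (b k) \<le> max K1 K2" for k
        using K1[of k] K2[of k] by (simp_all add: le_max_iff_disj)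
    qed
    then show ?thesis by (force simp: S_def Q)
  qed
  obtain Q where "Q \<in> S" "weakly_converges R Q"
    using opial[of S R] P conv cluster by blast
  then obtain p q where pq: "(p, q) \<in> extended_solution_set A B"
    and R_lim: "weakly_converges R (p, l *\<^sub>R q)" by (auto simp: S_def)
  have zw: "(\<lambda>k. inner (z k, w k) h) \<longlonglongrightarrow> inner (p, q) h" for h
    by (rule unscale[OF R_lim[unfolded weakly_converges_def, rule_format]])
  have "(\<lambda>k. (x k, b k) - (z k, w k)) \<longlonglongrightarrow> 0"
    using tendsto_Pair[OF z_x w_b] by (simp only: diff_Pair zero_prod_def)
  from weak_tendsto_perturb[OF zw this]
  have "weakly_converges (\<lambda>k. (x k, b k)) (p, q)" by (simp add: weakly_converges_def)
  moreover have "(\<lambda>k. (y (Suc k), - a (Suc k)) - (z k, w k)) \<longlonglongrightarrow> 0"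
    using tendsto_Pair[OF z_y w_a] by (simp only: diff_Pair zero_prod_def)
  from weak_tendsto_perturb[OF zw this]
  have "(\<lambda>k. inner (y k, - a k) h) \<longlonglongrightarrow> inner (p, q) h" for h by (rule LIMSEQ_imp_Suc)
  then have "weakly_converges (\<lambda>k. (y k, - a k)) (p, q)" by (simp add: weakly_converges_def)
  moreover have "weakly_converges (\<lambda>k. (z k, w k)) (p, q)"
    using zw by (simp add: weakly_converges_def)
  ultimately show ?thesis using pq by blast
qed

end
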